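(* Let $n\ge1$ be an integer and $L>0$. Let $r\in(0,1)$ be the unique solution in $(0,1)$ of $r^n(1+n(1+r))=1$, and put $\eta=r^n$. Let $f:\mathbb{R}^d\to\mathbb{R}$ be the quadratic $f(x)=L\|x\|^2/2$, with minimizer $x_\star=0$. Then for every initial point $x_0\in\mathbb{R}^d$, the iterates $x_{i+1}=x_i-\frac{1+r}{L}\nabla f(x_i)$, $i=0,\ldots,n-1$, satisfy with equality $$\frac{1-\eta}{2L}\|\nabla f(x_n)\|^2+\frac{\eta^2L}{2}\|x_n-x_\star\|^2+(\eta-\eta^2)\bigl(f(x_n)-f(x_\star)\bigr)=\frac{\eta^2L}{2}\|x_0-x_\star\|^2 .$$
   Context: $\|\cdot\|$ is the Euclidean norm. *)

theory Defs
  imports "HOL-Analysis.Analysis"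
begin

(* Junk value where f has no gradient at x. *)
definition grad :: "('a::real_inner \<Rightarrow> real) \<Rightarrow> 'a \<Rightarrow> 'a" where
  "grad f x = (THE D. GDERIV f x :> D)"

lemma grad_eqI:
  assumes "GDERIV f x :> D"
  shows "grad f x = D"
  unfolding grad_def
proof (rule the_equality)
  fix E assume "GDERIV f x :> E"
  then have "(\<lambda>h. inner h E) = (\<lambda>h. inner h D)"
    using assms unfolding gderiv_def by (rule has_derivative_unique)
  then have "inner (E - D) E = inner (E - D) D"
    by (rule fun_cong)
  then have "inner (E - D) (E - D) = 0"
    by (simp add: inner_diff_right)
  then show "E = D"
    by simp
qed (rule assms)

end

theory Submission
  imports Defs
begin

text \<open>For this $f$ each step multiplies the iterate by $-r$, hence
  $\|x_n\|^2 = r^{2n}\|x_0\|^2 = \eta^2\|x_0\|^2$, and the three terms on the left-hand side carry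
  the weights $1-\eta$, $\eta^2$ and $\eta-\eta^2$ of $L\|x_n\|^2/2$, which sum to $1$.\<close>

lemma grad_half_norm_square:
  fixes y :: "'a::real_inner"
  shows "grad (\<lambda>y. L * (norm y)\<^sup>2 / 2) y = L *\<^sub>R y"
  by (rule grad_eqI)
    (auto simp: gderiv_def power2_norm_eq_inner inner_commute intro!: derivative_eq_intros)

text \<open>The left-hand side is strictly increasing for s \<ge> 0, which gives uniqueness, and
  passes from 0 at s = 0 to 1 + 2n at s = 1, which gives existence by the intermediate value
  theorem. This makes the \<open>THE\<close> that specifies \<open>r\<close> meaningful.\<close>

lemma ex1_rate:
  fixes n :: nat
  assumes "1 \<le> n"
  shows "\<exists>!s::real. s \<in> {0<..<1} \<and> s ^ n * (1 + real n * (1 + s)) = 1"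
proof -
  define g where "g = (\<lambda>s::real. s ^ n * (1 + real n * (1 + s)))"
  have mono: "g s < g t" if "0 \<le> s" "s < t" for s t
    unfolding g_def using that assms
    by (intro mult_strict_mono power_strict_mono mult_strict_left_mono add_strict_left_mono)
      (auto intro: add_pos_nonneg)
  \<comment> \<open>Here n \<ge> 1 matters: it makes \<open>0 ^ n\<close> vanish, whereas
    \<open>0 ^ 0\<close> is 1.\<close>
  have g0: "g 0 = 0" and g1: "1 < g 1"
    using assms by (simp_all add: g_def)
  have "\<exists>s\<ge>0. s \<le> 1 \<and> g s = 1"
  proof (rule IVT')
    show "continuous_on {0..1} g"
      unfolding g_def by (intro continuous_intros)
  qed (use g0 g1 in auto)
  then obtain s where s: "0 \<le> s" "s \<le> 1" "g s = 1"
    by blast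
  \<comment> \<open>The intermediate value theorem only gives a point of the closed interval; the
    values of \<open>g\<close> at the endpoints exclude both.\<close>
  moreover from s g0 g1 have "s \<noteq> 0" "s \<noteq> 1"
    by auto
  ultimately have "s \<in> {0<..<1} \<and> g s = 1"
    by simp
  moreover have "t = u" if "t \<in> {0<..<1} \<and> g t = 1" "u \<in> {0<..<1} \<and> g u = 1" for t u
    using that mono[of t u] mono[of u t] by (cases t u rule: linorder_cases) auto
  ultimately show ?thesis
    unfolding g_def by blast
qed

theorem proposition5p2:
  fixes n :: nat and L r \<eta> :: real
    and f :: "real ^ 'd \<Rightarrow> real"
    and x\<^sub>0 x_star :: "real ^ 'd"
    and x :: "nat \<Rightarrow> real ^ 'd"
  assumes n: "1 \<le> n"
    and L: "0 < L"
    and r: "r = (THE s. s \<in> {0<..<1} \<and> s ^ n * (1 + real n * (1 + s)) = 1)"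
    and eta: "\<eta> = r ^ n"
    and f: "f = (\<lambda>y. L * (norm y)\<^sup>2 / 2)"
    and x_star: "x_star = 0"
    and init: "x 0 = x\<^sub>0"
    and iter: "\<And>i. i < n \<Longrightarrow> x (Suc i) = x i - ((1 + r) / L) *\<^sub>R grad f (x i)"
  shows "(\<exists>!s::real. s \<in> {0<..<1} \<and> s ^ n * (1 + real n * (1 + s)) = 1) \<and>
    is_arg_min f (\<lambda>_. True) x_star \<and>
    (1 - \<eta>) / (2 * L) * (norm (grad f (x n)))\<^sup>2
      + \<eta>\<^sup>2 * L / 2 * (norm (x n - x_star))\<^sup>2
      + (\<eta> - \<eta>\<^sup>2) * (f (x n) - f x_star)
    = \<eta>\<^sup>2 * L / 2 * (norm (x\<^sub>0 - x_star))\<^sup>2"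
proof (intro conjI)
  show "\<exists>!s::real. s \<in> {0<..<1} \<and> s ^ n * (1 + real n * (1 + s)) = 1"
    using n by (rule ex1_rate)
  show "is_arg_min f (\<lambda>_. True) x_star"
    using L by (auto simp: is_arg_min_def f x_star not_less)
  have grad: "grad f y = L *\<^sub>R y" for y
    unfolding f by (rule grad_half_norm_square)
  \<comment> \<open>The bound \<open>i \<le> n\<close> is part of the induction because the
    recurrence is given only for indices below \<open>n\<close>.\<close>
  have "x i = (- r) ^ i *\<^sub>R x\<^sub>0" if "i \<le> n" for i
    using that
  proof (induction i)
    case 0
    then show ?case
      using init by simp
  next
    case (Suc i)
    \<comment> \<open>After cancelling \<open>L\<close>, both terms are multiples of
      \<open>x\<^sub>0\<close>; comparing scalars leaves 1 - (1 + r) = -r.\<close>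
    then show ?case
      using L by (simp add: iter grad flip: scaleR_left_diff_distrib) (simp add: algebra_simps)
  qed
  \<comment> \<open>Squaring removes the sign of \<open>(- r) ^ n\<close>.\<close>
  then have "(norm (x n))\<^sup>2 = \<eta>\<^sup>2 * (norm x\<^sub>0)\<^sup>2"
    by (simp add: eta power_mult_distrib)
  \<comment> \<open>The squared gradient norm contributes \<open>L\<^sup>2\<close>, which turns 1 /
    (2L) into L / 2, the scale of the other terms.\<close>
  then show "(1 - \<eta>) / (2 * L) * (norm (grad f (x n)))\<^sup>2
      + \<eta>\<^sup>2 * L / 2 * (norm (x n - x_star))\<^sup>2
      + (\<eta> - \<eta>\<^sup>2) * (f (x n) - f x_star)
    = \<eta>\<^sup>2 * L / 2 * (norm (x\<^sub>0 - x_star))\<^sup>2"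
    unfolding grad using L
    by (simp add: f x_star power_mult_distrib field_simps power2_eq_square)
qed

end
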